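(* Let $H$ be a Hilbert space and let $\Phi$ be a collection of functions $\phi:H\to\mathbb{R}$, contained in a linear space $G$ and closed under addition of constants. Let $J:\Phi\to(-\infty,+\infty]$, $I:H\to(-\infty,+\infty]$, $\mathcal{A}:\Phi\to\Phi$, $\mathcal{B}:H\to H$. Consider $f:\Phi\to H$ with image $\mathrm{Im}\,f$, and assume $\mathrm{dom}\,f\subset\mathrm{dom}\,\mathcal{A}$. 1. Let $D(x,\phi)=J(\phi)-\langle\mathcal{A}(\phi),x\rangle_\Phi+I(x)$ for $x\in H$, $\phi\in\Phi$. The following are equivalent: (i) There exists $\varphi:H\to(-\infty,+\infty]$ such that $f(\phi)\in\arg\min_{z\in H}\big(D(z,\phi)+\varphi(z)\big)$ for each $\phi\in\Phi$. (ii) There is a function $g:H\to(-\infty,+\infty]$ with $\mathrm{Im}\,f\subset\mathrm{dom}\,g$ which is $\Phi$-convex on $\mathrm{Im}\,f$ and such that $\mathcal{A}(f^{-1}(x))\subset\partial_\Phi g(x)$ for each $x\in\mathrm{Im}\,f$. 2. Let $\tilde D(x,\phi)=J(\phi)-\langle\phi,\mathcal{B}(x)\rangle_\Phi+I(x)$ for $x\in H$, $\phi\in\Phi$. The following are equivalent: (i) There exists $\varphi:H\to(-\infty,+\infty]$ such that $f(\phi)\in\arg\min_{x\in H}\big(\tilde D(x,\phi)+\varphi(x)\big)$ for each $\phi\in\Phi$. (ii) There is an $H$-convex function $\psi:\Phi\to(-\infty,+\infty]$ such that $\mathcal{B}(f(\phi))\in\partial_\Phi\psi(\phi)$ for each 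$\phi\in\Phi$.
   Context: Pairing: $\langle\phi,x\rangle_\Phi:=\phi(x)$ for $\phi\in\Phi$, $x\in H$. $\arg\min$ denotes the set of global minimizers. $\mathrm{dom}\,g=\{x: g(x)<+\infty\}$; a function is proper if its domain is nonempty. $f^{-1}(x)=\{\phi\in\Phi: f(\phi)=x\}$. $\Phi$-convexity: $g:H\to(-\infty,+\infty]$ is $\Phi$-convex at $x$ if $g(x)=\sup\{\phi(x):\phi\in\Phi,\ \phi\le g \text{ on } H\}$; it is $\Phi$-convex on a set if it is $\Phi$-convex at each point of that set. $\Phi$-subdifferential on $H$: for $g:H\to(-\infty,+\infty]$ proper and $x\in\mathrm{dom}\,g$, $\partial_\Phi g(x)=\{\phi\in\Phi: g(y)-g(x)\ge\phi(y)-\phi(x)\ \ \forall y\in H\}$ (empty if $x\notin\mathrm{dom}\,g$). Subdifferential on $\Phi$: for $\psi:\Phi\to(-\infty,+\infty]$ proper and $\phi\in\mathrm{dom}\,\psi$, $\partial_\Phi\psi(\phi)=\{x\in H:\psi(\phi')-\psi(\phi)\ge\phi'(x)-\phi(x)\ \ \forall\phi'\in\Phi\}\subset H$ (empty if $\phi\notin\mathrm{dom}\,\psi$). $H$-convexity: $\psi:\Phi\to(-\infty,+\infty]$ is $H$-convex if at each $\phi\in\Phi$ it equals the supremum of the values at $\phi$ of all functions of the form $\phi'\mapsto\phi'(y)+c$ ($y\in H$, $c\in\mathbb{R}$) that are $\le\psi$ on $\Phi$.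
   Formalization: Minimizers are required to have value below +∞ (the function identically +∞ has none), and in both parts (ii)⇒(i) is stated assuming J is finite on Φ and I is finite on Im f; (i)⇒(ii) needs no such assumption. *)

theory Defs
  imports "HOL-Analysis.Analysis" "HOL-Library.Function_Algebras"
begin

text \<open>
  A function with values in \<open>(-\<infinity>, +\<infinity>]\<close> is an \<^typ>\<open>ereal\<close>-valued function lying in
  \<open>S \<rightarrow> {-\<infinity><..}\<close>, where \<open>S\<close> is its domain of definition; a function defined on the class
  \<open>\<Phi>\<close> only is a total function whose values outside \<open>\<Phi>\<close> are never used.
\<close>

definition effdom :: "('a \<Rightarrow> ereal) \<Rightarrow> 'a set" where
  "effdom g = {x. g x < \<infinity>}"

text \<open>
  The usual convention of variational analysis: the function that is constantly \<open>+\<infinity>\<close> has no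
  minimizers, so a minimizer always lies in the effective domain.
\<close>

definition argmins :: "('a \<Rightarrow> ereal) \<Rightarrow> 'a set" where
  "argmins h = {x \<in> effdom h. is_arg_min h (\<lambda>_. True) x}"

definition Phi_convex_at :: "('a \<Rightarrow> real) set \<Rightarrow> ('a \<Rightarrow> ereal) \<Rightarrow> 'a \<Rightarrow> bool" where
  "Phi_convex_at \<Phi> g x \<longleftrightarrow>
     g x = Sup {ereal (\<phi> x) | \<phi>. \<phi> \<in> \<Phi> \<and> (\<forall>y. ereal (\<phi> y) \<le> g y)}"

definition Phi_convex_on :: "('a \<Rightarrow> real) set \<Rightarrow> 'a set \<Rightarrow> ('a \<Rightarrow> ereal) \<Rightarrow> bool" where
  "Phi_convex_on \<Phi> S g \<longleftrightarrow> (\<forall>x\<in>S. Phi_convex_at \<Phi> g x)"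

definition Phi_subdiff :: "('a \<Rightarrow> real) set \<Rightarrow> ('a \<Rightarrow> ereal) \<Rightarrow> 'a \<Rightarrow> ('a \<Rightarrow> real) set" where
  "Phi_subdiff \<Phi> g x =
     {\<phi> \<in> \<Phi>. x \<in> effdom g \<and> (\<forall>y. g y - g x \<ge> ereal (\<phi> y - \<phi> x))}"

text \<open>The subdifferential of a function \<open>\<psi>\<close> on \<open>\<Phi>\<close>; it is a set of points.\<close>

definition point_subdiff ::
    "('a \<Rightarrow> real) set \<Rightarrow> (('a \<Rightarrow> real) \<Rightarrow> ereal) \<Rightarrow> ('a \<Rightarrow> real) \<Rightarrow> 'a set" where
  "point_subdiff \<Phi> \<psi> \<phi> =
     {x. \<phi> \<in> \<Phi> \<inter> effdom \<psi> \<and> (\<forall>\<phi>'\<in>\<Phi>. \<psi> \<phi>' - \<psi> \<phi> \<ge> ereal (\<phi>' x - \<phi> x))}"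

definition H_convex :: "('a \<Rightarrow> real) set \<Rightarrow> (('a \<Rightarrow> real) \<Rightarrow> ereal) \<Rightarrow> bool" where
  "H_convex \<Phi> \<psi> \<longleftrightarrow>
     (\<forall>\<phi>\<in>\<Phi>. \<psi> \<phi> = Sup {ereal (\<phi> y + c) | y c. \<forall>\<phi>'\<in>\<Phi>. ereal (\<phi>' y + c) \<le> \<psi> \<phi>'})"

end

theory Submission imports Defs begin

text \<open>
  Only the points of \<open>Im f\<close> matter: the penalty \<open>\<theta>\<close> and the function \<open>g\<close> may be reset
  to \<open>+\<infinity>\<close> elsewhere. For a real coupling \<open>K\<close> (with \<open>K x \<phi> = \<A> \<phi> x\<close> in part 1 and
  \<open>K x \<phi> = \<phi> (\<B> x)\<close> in part 2) each of the four conditions then says that some real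
  potential \<open>h\<close> on \<open>Im f\<close> satisfies
  \<open>K (f \<phi>') \<phi> - h (f \<phi>') \<le> K (f \<phi>) \<phi> - h (f \<phi>)\<close> for all \<open>\<phi>\<close>, \<open>\<phi>'\<close>.
  The potential is \<open>I + \<theta>\<close>, respectively \<open>g\<close>, and in terms of \<open>\<psi>\<close> it is
  \<open>h (f \<phi>) = \<phi> (\<B> (f \<phi>)) - \<psi> \<phi>\<close>.
\<close>

text \<open>In the language of optimal transport, the graph of \<open>f\<close> lies in the
  \<open>K\<close>-subdifferential of \<open>h\<close>. A real-valued \<open>h\<close> keeps
  infinite values out of this common form; its values off the image of \<open>f\<close> are
  irrelevant.\<close>

definition potential_on :: "'p set \<Rightarrow> ('p \<Rightarrow> 'x) \<Rightarrow> ('x \<Rightarrow> 'p \<Rightarrow> real) \<Rightarrow> ('x \<Rightarrow> real) \<Rightarrow> bool" where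
  "potential_on P f K h \<longleftrightarrow>
     (\<forall>p\<in>P. \<forall>q\<in>P. K (f q) p - h (f q) \<le> K (f p) p - h (f p))"

lemma potential_on_D:
  assumes "potential_on P f K h" "p \<in> P" "q \<in> P"
  shows "K (f q) p - h (f q) \<le> K (f p) p - h (f p)"
  using assms by (simp add: potential_on_def)

lemma mem_argmins_iff: "x \<in> argmins h \<longleftrightarrow> h x < \<infinity> \<and> (\<forall>y. h x \<le> h y)"
  by (auto simp: argmins_def effdom_def is_arg_min_def not_less)

text \<open>The minimum at \<open>f p\<close> is below \<infinity> and no summand is -\<infinity>,
  so every summand there is real. Comparing the objective for \<open>p\<close> at \<open>f p\<close>
  and \<open>f q\<close>, the common term \<open>J p\<close> cancels.\<close>

lemma argmins_imp_potential:
  fixes J :: "'p \<Rightarrow> ereal" and I \<theta> :: "'x \<Rightarrow> ereal" and K :: "'x \<Rightarrow> 'p \<Rightarrow> real"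
  assumes J: "J \<in> P \<rightarrow> {-\<infinity><..}"
    and I: "I \<in> UNIV \<rightarrow> {-\<infinity><..}" and \<theta>: "\<theta> \<in> UNIV \<rightarrow> {-\<infinity><..}"
    and min: "\<And>p. p \<in> P \<Longrightarrow> f p \<in> argmins (\<lambda>x. J p - ereal (K x p) + I x + \<theta> x)"
  shows "potential_on P f K (\<lambda>x. real_of_ereal (I x + \<theta> x))"
  unfolding potential_on_def
proof (intro ballI)
  have finite: "\<exists>j a b. J p = ereal j \<and> I (f p) = ereal a \<and> \<theta> (f p) = ereal b" if "p \<in> P" for p
  proof -
    have "J p - ereal (K (f p) p) + I (f p) + \<theta> (f p) < \<infinity>"
      using min[OF that] by (simp add: mem_argmins_iff)
    moreover have "J p > -\<infinity>" "I (f p) > -\<infinity>" "\<theta> (f p) > -\<infinity>"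
      using J I \<theta> that by auto
    ultimately show ?thesis
      by (cases "J p"; cases "I (f p)"; cases "\<theta> (f p)") auto
  qed
  fix p q assume "p \<in> P" "q \<in> P"
  obtain j a b where "J p = ereal j" "I (f p) = ereal a" "\<theta> (f p) = ereal b"
    using finite[OF \<open>p \<in> P\<close>] by blast
  \<comment> \<open>Finiteness at \<open>f q\<close> comes from the minimization problem of
    \<open>q\<close>, not from that of \<open>p\<close>.\<close>
  moreover obtain c d where "I (f q) = ereal c" "\<theta> (f q) = ereal d"
    using finite[OF \<open>q \<in> P\<close>] by blast
  moreover have "J p - ereal (K (f p) p) + I (f p) + \<theta> (f p)
      \<le> J p - ereal (K (f q) p) + I (f q) + \<theta> (f q)"
    using min[OF \<open>p \<in> P\<close>] by (simp add: mem_argmins_iff)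
  ultimately show "K (f q) p - real_of_ereal (I (f q) + \<theta> (f q))
      \<le> K (f p) p - real_of_ereal (I (f p) + \<theta> (f p))"
    by simp
qed

lemma potential_imp_argmins:
  fixes J :: "'p \<Rightarrow> ereal" and I :: "'x \<Rightarrow> ereal" and K :: "'x \<Rightarrow> 'p \<Rightarrow> real"
  assumes J: "J \<in> P \<rightarrow> {-\<infinity><..}" "P \<subseteq> effdom J"
    and I: "I \<in> UNIV \<rightarrow> {-\<infinity><..}" "f ` P \<subseteq> effdom I"
    and h: "potential_on P f K h"
  shows "\<exists>\<theta> \<in> UNIV \<rightarrow> {-\<infinity><..}. \<forall>p\<in>P. f p \<in> argmins (\<lambda>x. J p - ereal (K x p) + I x + \<theta> x)"
proof (intro bexI ballI)
  \<comment> \<open>The penalty turns \<open>I + \<theta>\<close> into \<open>h\<close> on the image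
    and into \<infinity> elsewhere. Subtracting \<open>I x\<close> is harmless because
    \<open>I\<close> is real on the image.\<close>
  define \<theta> where "\<theta> x = (if x \<in> f ` P then ereal (h x) - I x else \<infinity>)" for x
  have I_fin: "\<exists>a. I x = ereal a" if "x \<in> f ` P" for x
  proof -
    have "I x < \<infinity>" "I x > -\<infinity>" using I that by (auto simp: effdom_def)
    then show ?thesis by (cases "I x") auto
  qed
  have "\<theta> x > -\<infinity>" for x
    using I_fin[of x] by (auto simp: \<theta>_def)
  then show "\<theta> \<in> UNIV \<rightarrow> {-\<infinity><..}" by auto
  fix p assume p: "p \<in> P"
  have "J p < \<infinity>" "J p > -\<infinity>" using J p by (auto simp: effdom_def)
  then obtain j where j: "J p = ereal j" by (cases "J p") auto
  have on: "J p - ereal (K (f q) p) + I (f q) + \<theta> (f q) = ereal (j - (K (f q) p - h (f q)))"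
    if "q \<in> P" for q
    using I_fin[of "f q"] that by (auto simp: \<theta>_def j)
  have off: "J p - ereal (K x p) + I x + \<theta> x = \<infinity>" if "x \<notin> f ` P" for x
    using that by (simp add: \<theta>_def)
  have "J p - ereal (K (f p) p) + I (f p) + \<theta> (f p) \<le> J p - ereal (K x p) + I x + \<theta> x" for x
  proof (cases "x \<in> f ` P")
    case True
    then obtain q where q: "q \<in> P" "x = f q" by auto
    show ?thesis
      unfolding q(2) on[OF p] on[OF q(1)] using potential_on_D[OF h p q(1)] by simp
  qed (simp add: off)
  then show "f p \<in> argmins (\<lambda>x. J p - ereal (K x p) + I x + \<theta> x)"
    by (simp add: mem_argmins_iff on[OF p])
qed

lemma effdom_real:
  assumes "x \<in> effdom g" "g x > -\<infinity>"
  shows "\<exists>a. g x = ereal a"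
  using assms by (cases "g x") (auto simp: effdom_def)

lemma Phi_subdiff_imp_potential:
  fixes \<Phi> :: "('x \<Rightarrow> real) set" and g :: "'x \<Rightarrow> ereal"
  assumes g: "g \<in> UNIV \<rightarrow> {-\<infinity><..}" "f ` P \<subseteq> effdom g"
    and sub: "\<And>p. p \<in> P \<Longrightarrow> A p \<in> Phi_subdiff \<Phi> g (f p)"
  shows "potential_on P f (\<lambda>x p. A p x) (\<lambda>x. real_of_ereal (g x))"
  unfolding potential_on_def
proof (intro ballI)
  fix p q assume pq: "p \<in> P" "q \<in> P"
  obtain a b where "g (f p) = ereal a" "g (f q) = ereal b"
    using effdom_real[of "f p" g] effdom_real[of "f q" g] g pq by blast
  moreover have "g (f q) - g (f p) \<ge> ereal (A p (f q) - A p (f p))"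
    using sub[OF pq(1)] by (simp add: Phi_subdiff_def)
  ultimately show "A p (f q) - real_of_ereal (g (f q)) \<le> A p (f p) - real_of_ereal (g (f p))"
    by simp
qed

text \<open>A subgradient shifted by the constant \<open>g x - \<phi> x\<close> stays in
  \<open>\<Phi>\<close> and is a minorant of \<open>g\<close> touching it at \<open>x\<close>, so
  the supremum is attained.\<close>

lemma Phi_subdiff_imp_Phi_convex_at:
  assumes shift: "\<And>\<phi> c. \<phi> \<in> \<Phi> \<Longrightarrow> (\<lambda>x. \<phi> x + c) \<in> \<Phi>"
    and \<phi>: "\<phi> \<in> Phi_subdiff \<Phi> g x" and g: "g x > -\<infinity>"
  shows "Phi_convex_at \<Phi> g x"
  unfolding Phi_convex_at_def
proof (rule antisym)
  let ?S = "{ereal (\<phi> x) |\<phi>. \<phi> \<in> \<Phi> \<and> (\<forall>y. ereal (\<phi> y) \<le> g y)}"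
  show "Sup ?S \<le> g x" by (auto intro: Sup_least)
  obtain a where a: "g x = ereal a"
    using effdom_real[of x g] \<phi> g by (auto simp: Phi_subdiff_def)
  have "ereal (\<phi> y + (a - \<phi> x)) \<le> g y" for y
  proof -
    have "g y - g x \<ge> ereal (\<phi> y - \<phi> x)" using \<phi> by (simp add: Phi_subdiff_def)
    then show ?thesis by (cases "g y") (auto simp: a)
  qed
  moreover have "(\<lambda>y. \<phi> y + (a - \<phi> x)) \<in> \<Phi>"
    using \<phi> by (intro shift) (simp add: Phi_subdiff_def)
  ultimately have "ereal (\<phi> x + (a - \<phi> x)) \<le> Sup ?S"
    by (intro Sup_upper CollectI exI[of _ "\<lambda>y. \<phi> y + (a - \<phi> x)"]) simp
  then show "g x \<le> Sup ?S" by (simp add: a)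
qed

text \<open>On the image the subgradient inequality is a rearranged potential inequality; elsewhere
  its left side is \<infinity>.\<close>

lemma potential_imp_Phi_subdiff:
  fixes \<Phi> :: "('x \<Rightarrow> real) set"
  assumes A: "A \<in> P \<rightarrow> \<Phi>"
    and h: "potential_on P f (\<lambda>x p. A p x) h" and p: "p \<in> P"
  shows "A p \<in> Phi_subdiff \<Phi> (\<lambda>x. if x \<in> f ` P then ereal (h x) else \<infinity>) (f p)"
proof -
  have "A p (f q) - A p (f p) \<le> h (f q) - h (f p)" if "q \<in> P" for q
    using potential_on_D[OF h p that] by linarith
  then show ?thesis
    using A p by (auto simp: Phi_subdiff_def effdom_def)
qed

text \<open>The formula \<open>\<phi> (B x) - \<psi> \<phi>\<close> for the potential at
  \<open>x\<close> refers to a preimage \<open>\<phi>\<close> of \<open>x\<close>, and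
  \<open>f\<close> need not be injective; one preimage is therefore chosen for each image
  point.\<close>

lemma point_subdiff_imp_potential:
  fixes \<Phi> :: "('x \<Rightarrow> real) set" and f :: "('x \<Rightarrow> real) \<Rightarrow> 'z"
  assumes \<psi>: "\<psi> \<in> \<Phi> \<rightarrow> {-\<infinity><..}"
    and sub: "\<And>\<phi>. \<phi> \<in> \<Phi> \<Longrightarrow> B (f \<phi>) \<in> point_subdiff \<Phi> \<psi> \<phi>"
  shows "\<exists>h. potential_on \<Phi> f (\<lambda>x \<phi>. \<phi> (B x)) h"
proof
  define r where "r \<phi> = real_of_ereal (\<psi> \<phi>)" for \<phi>
  have \<psi>r: "\<psi> \<phi> = ereal (r \<phi>)" if "\<phi> \<in> \<Phi>" for \<phi>
  proof -
    have "\<phi> \<in> effdom \<psi>" "\<psi> \<phi> > -\<infinity>" using \<psi> sub[OF that] that by (auto simp: point_subdiff_def)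
    then show ?thesis using effdom_real by (fastforce simp: r_def)
  qed
  have ineq: "\<phi>' (B (f \<phi>)) - \<phi> (B (f \<phi>)) \<le> r \<phi>' - r \<phi>" if "\<phi> \<in> \<Phi>" "\<phi>' \<in> \<Phi>" for \<phi> \<phi>'
    using sub[OF that(1)] that by (force simp: point_subdiff_def \<psi>r)
  define s where "s x = (SOME \<phi>. \<phi> \<in> \<Phi> \<and> f \<phi> = x)" for x
  have s: "s (f \<phi>) \<in> \<Phi>" "f (s (f \<phi>)) = f \<phi>" if "\<phi> \<in> \<Phi>" for \<phi>
    using someI[of "\<lambda>\<phi>'. \<phi>' \<in> \<Phi> \<and> f \<phi>' = f \<phi>" \<phi>] that by (auto simp: s_def)
  show "potential_on \<Phi> f (\<lambda>x \<phi>. \<phi> (B x)) (\<lambda>x. s x (B x) - r (s x))"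
    unfolding potential_on_def
  proof (intro ballI)
    fix \<phi> \<phi>' assume *: "\<phi> \<in> \<Phi>" "\<phi>' \<in> \<Phi>"
    show "\<phi> (B (f \<phi>')) - (s (f \<phi>') (B (f \<phi>')) - r (s (f \<phi>')))
        \<le> \<phi> (B (f \<phi>)) - (s (f \<phi>) (B (f \<phi>)) - r (s (f \<phi>)))"
      \<comment> \<open>Both sides are compared with \<open>r \<phi>\<close>: the subgradient
        inequality at \<open>\<phi>\<close>, tested with \<open>s (f \<phi>)\<close>, bounds the
        right side from below, and the one at \<open>s (f \<phi>')\<close>, tested with
        \<open>\<phi>\<close>, bounds the left side from above.\<close>
      using ineq[OF *(1) s(1)[OF *(1)]] ineq[OF s(1)[OF *(2)] *(1)] s(2) *
      by (simp add: algebra_simps)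
  qed
qed

text \<open>This \<open>\<psi>\<close> is the conjugate of \<open>h\<close>: the maximum over image
  points \<open>x\<close> of the elementary functions sending \<open>\<phi>\<close> to
  \<open>\<phi> (B x) - h x\<close>, attained at \<open>x = f \<phi>\<close>. A maximum of such
  functions is \<open>H\<close>-convex, and the maximizing one gives the subgradient.\<close>

lemma potential_imp_point_subdiff:
  fixes \<Phi> :: "('x \<Rightarrow> real) set" and f :: "('x \<Rightarrow> real) \<Rightarrow> 'z"
  assumes h: "potential_on \<Phi> f (\<lambda>x \<phi>. \<phi> (B x)) h"
  defines "\<psi> \<equiv> \<lambda>\<phi>. ereal (\<phi> (B (f \<phi>)) - h (f \<phi>))"
  shows "H_convex \<Phi> \<psi>" and "\<phi> \<in> \<Phi> \<Longrightarrow> B (f \<phi>) \<in> point_subdiff \<Phi> \<psi> \<phi>"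
proof -
  have below: "ereal (\<phi>' (B (f \<phi>)) + - h (f \<phi>)) \<le> \<psi> \<phi>'" if "\<phi> \<in> \<Phi>" "\<phi>' \<in> \<Phi>" for \<phi> \<phi>'
    using potential_on_D[OF h that(2,1)] by (simp add: \<psi>_def)
  show "B (f \<phi>) \<in> point_subdiff \<Phi> \<psi> \<phi>" if "\<phi> \<in> \<Phi>" for \<phi>
    using below[OF that] that by (fastforce simp: point_subdiff_def effdom_def \<psi>_def)
  show "H_convex \<Phi> \<psi>"
    unfolding H_convex_def
  proof (intro ballI antisym)
    fix \<phi> assume \<phi>: "\<phi> \<in> \<Phi>"
    let ?S = "{ereal (\<phi> y + c) |y c. \<forall>\<phi>'\<in>\<Phi>. ereal (\<phi>' y + c) \<le> \<psi> \<phi>'}"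
    show "Sup ?S \<le> \<psi> \<phi>" using \<phi> by (auto intro: Sup_least)
    have "ereal (\<phi> (B (f \<phi>)) + - h (f \<phi>)) \<le> Sup ?S"
      using below[OF \<phi>] by (intro Sup_upper) blast
    then show "\<psi> \<phi> \<le> Sup ?S" by (simp add: \<psi>_def)
  qed
qed

text \<open>Points of \<open>argmins\<close> have value below \<infinity>, so the minimization
  conditions force \<open>J\<close> to be finite on \<open>\<Phi>\<close> and \<open>I\<close> on
  the image of \<open>f\<close>. The subdifferential conditions do not mention \<open>J\<close> or
  \<open>I\<close>, hence \<open>finite_values\<close> in the converse directions.\<close>

theorem theorem1:
  fixes G \<Phi> :: "('h::{real_inner, complete_space} \<Rightarrow> real) set"
    and J :: "('h \<Rightarrow> real) \<Rightarrow> ereal"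
    and I :: "'h \<Rightarrow> ereal"
    and \<A> :: "('h \<Rightarrow> real) \<Rightarrow> ('h \<Rightarrow> real)"
    and \<B> :: "'h \<Rightarrow> 'h"
    and f :: "('h \<Rightarrow> real) \<Rightarrow> 'h"
    and D D' :: "'h \<Rightarrow> ('h \<Rightarrow> real) \<Rightarrow> ereal"
  assumes "module.subspace (\<lambda>(c::real) (u::'h \<Rightarrow> real) x. c * u x) G"
    and "\<Phi> \<subseteq> G"
    and "\<And>\<phi> c. \<phi> \<in> \<Phi> \<Longrightarrow> (\<lambda>x. \<phi> x + c) \<in> \<Phi>"
    and "J \<in> \<Phi> \<rightarrow> {-\<infinity><..}"
    and "I \<in> UNIV \<rightarrow> {-\<infinity><..}"
    and "\<A> \<in> \<Phi> \<rightarrow> \<Phi>"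
    and "\<And>x \<phi>. D x \<phi> = J \<phi> - ereal (\<A> \<phi> x) + I x"
    and "\<And>x \<phi>. D' x \<phi> = J \<phi> - ereal (\<phi> (\<B> x)) + I x"
  shows
    "let finite_values = (\<Phi> \<subseteq> effdom J \<and> f ` \<Phi> \<subseteq> effdom I);
         i\<^sub>1 = (\<exists>\<theta> \<in> UNIV \<rightarrow> {-\<infinity><..}. \<forall>\<phi>\<in>\<Phi>. f \<phi> \<in> argmins (\<lambda>z. D z \<phi> + \<theta> z));
         ii\<^sub>1 = (\<exists>g \<in> UNIV \<rightarrow> {-\<infinity><..}. f ` \<Phi> \<subseteq> effdom g \<and> Phi_convex_on \<Phi> (f ` \<Phi>) g \<and>
                 (\<forall>x \<in> f ` \<Phi>. \<A> ` {\<phi>\<in>\<Phi>. f \<phi> = x} \<subseteq> Phi_subdiff \<Phi> g x));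
         i\<^sub>2 = (\<exists>\<theta> \<in> UNIV \<rightarrow> {-\<infinity><..}. \<forall>\<phi>\<in>\<Phi>. f \<phi> \<in> argmins (\<lambda>x. D' x \<phi> + \<theta> x));
         ii\<^sub>2 = (\<exists>\<psi> \<in> \<Phi> \<rightarrow> {-\<infinity><..}. H_convex \<Phi> \<psi> \<and>
                 (\<forall>\<phi>\<in>\<Phi>. \<B> (f \<phi>) \<in> point_subdiff \<Phi> \<psi> \<phi>))
     in ((i\<^sub>1 \<longrightarrow> ii\<^sub>1) \<and> (finite_values \<longrightarrow> (i\<^sub>1 \<longleftrightarrow> ii\<^sub>1))) \<and>
        ((i\<^sub>2 \<longrightarrow> ii\<^sub>2) \<and> (finite_values \<longrightarrow> (i\<^sub>2 \<longleftrightarrow> ii\<^sub>2)))"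
proof -
  note shift = assms(3) and J = assms(4) and I = assms(5) and A = assms(6)
  let ?K\<^sub>1 = "\<lambda>x \<phi>. \<A> \<phi> x" and ?K\<^sub>2 = "\<lambda>x \<phi>. \<phi> (\<B> x)"
  define fin where "fin \<longleftrightarrow> \<Phi> \<subseteq> effdom J \<and> f ` \<Phi> \<subseteq> effdom I"
  define i1 where "i1 \<longleftrightarrow> (\<exists>\<theta> \<in> UNIV \<rightarrow> {-\<infinity><..}. \<forall>\<phi>\<in>\<Phi>. f \<phi> \<in> argmins (\<lambda>z. D z \<phi> + \<theta> z))"
  define ii1 where "ii1 \<longleftrightarrow> (\<exists>g \<in> UNIV \<rightarrow> {-\<infinity><..}. f ` \<Phi> \<subseteq> effdom g \<and> Phi_convex_on \<Phi> (f ` \<Phi>) g \<and>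
      (\<forall>x \<in> f ` \<Phi>. \<A> ` {\<phi>\<in>\<Phi>. f \<phi> = x} \<subseteq> Phi_subdiff \<Phi> g x))"
  define i2 where "i2 \<longleftrightarrow> (\<exists>\<theta> \<in> UNIV \<rightarrow> {-\<infinity><..}. \<forall>\<phi>\<in>\<Phi>. f \<phi> \<in> argmins (\<lambda>x. D' x \<phi> + \<theta> x))"
  define ii2 where "ii2 \<longleftrightarrow> (\<exists>\<psi> \<in> \<Phi> \<rightarrow> {-\<infinity><..}. H_convex \<Phi> \<psi> \<and>
      (\<forall>\<phi>\<in>\<Phi>. \<B> (f \<phi>) \<in> point_subdiff \<Phi> \<psi> \<phi>))"
  \<comment> \<open>Facts ending in \<open>_D\<close> extract a potential from a condition, those
    ending in \<open>_I\<close> rebuild the condition from one; only rebuilding a penalty calls for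
    \<open>fin\<close>.\<close>
  have i1_D: "\<exists>h. potential_on \<Phi> f ?K\<^sub>1 h" if i1
    using that argmins_imp_potential[OF J I, of _ f ?K\<^sub>1] unfolding i1_def assms(7) by blast
  have i2_D: "\<exists>h. potential_on \<Phi> f ?K\<^sub>2 h" if i2
    using that argmins_imp_potential[OF J I, of _ f ?K\<^sub>2] unfolding i2_def assms(8) by blast
  have i1_I: i1 if fin "potential_on \<Phi> f ?K\<^sub>1 h" for h
    using potential_imp_argmins[OF J _ I _ that(2)] that(1) unfolding i1_def assms(7) fin_def by blast
  have i2_I: i2 if fin "potential_on \<Phi> f ?K\<^sub>2 h" for h
    using potential_imp_argmins[OF J _ I _ that(2)] that(1) unfolding i2_def assms(8) fin_def by blast
  have ii1_D: "\<exists>h. potential_on \<Phi> f ?K\<^sub>1 h" if ii1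
  proof -
    obtain g where "g \<in> UNIV \<rightarrow> {-\<infinity><..}" "f ` \<Phi> \<subseteq> effdom g"
      and "\<And>\<phi>. \<phi> \<in> \<Phi> \<Longrightarrow> \<A> \<phi> \<in> Phi_subdiff \<Phi> g (f \<phi>)"
      using \<open>ii1\<close> unfolding ii1_def by blast
    then show ?thesis by (blast intro: Phi_subdiff_imp_potential)
  qed
  have ii1_I: ii1 if h: "potential_on \<Phi> f ?K\<^sub>1 h" for h
    unfolding ii1_def
  proof (intro bexI conjI)
    let ?g = "\<lambda>x. if x \<in> f ` \<Phi> then ereal (h x) else \<infinity>"
    show "?g \<in> UNIV \<rightarrow> {-\<infinity><..}" by auto
    show "f ` \<Phi> \<subseteq> effdom ?g" by (auto simp: effdom_def)
    have sub: "\<A> \<phi> \<in> Phi_subdiff \<Phi> ?g (f \<phi>)" if "\<phi> \<in> \<Phi>" for \<phi>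
      by (rule potential_imp_Phi_subdiff[OF A h that])
    show "\<forall>x \<in> f ` \<Phi>. \<A> ` {\<phi>\<in>\<Phi>. f \<phi> = x} \<subseteq> Phi_subdiff \<Phi> ?g x"
      using sub by blast
    show "Phi_convex_on \<Phi> (f ` \<Phi>) ?g"
      unfolding Phi_convex_on_def
    proof
      fix x assume "x \<in> f ` \<Phi>"
      \<comment> \<open>Any preimage of \<open>x\<close> supplies a subgradient at \<open>x\<close>,
        which already yields convexity there.\<close>
      then obtain \<phi> where "\<phi> \<in> \<Phi>" "x = f \<phi>" by blast
      then show "Phi_convex_at \<Phi> ?g x"
        using Phi_subdiff_imp_Phi_convex_at[OF shift sub] by simp
    qed
  qed
  have ii2_D: "\<exists>h. potential_on \<Phi> f ?K\<^sub>2 h" if ii2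
    using that point_subdiff_imp_potential[of _ \<Phi> \<B> f] unfolding ii2_def by blast
  have ii2_I: ii2 if h: "potential_on \<Phi> f ?K\<^sub>2 h" for h
    unfolding ii2_def
    using potential_imp_point_subdiff[OF h]
    by (intro bexI[of _ "\<lambda>\<phi>. ereal (\<phi> (\<B> (f \<phi>)) - h (f \<phi>))"]) auto
  show ?thesis
    unfolding Let_def fin_def[symmetric] i1_def[symmetric] ii1_def[symmetric]
      i2_def[symmetric] ii2_def[symmetric]
    using i1_D i1_I ii1_D ii1_I i2_D i2_I ii2_D ii2_I by blast
qed

end
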